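(* For every integer $n$, with $\phi=\sum_{k=0}^{\infty}2^k$ having the value $\phi=-1-\dfrac{W_n(-\log 2)}{\log 2}$, one has $$\log 2=\frac{\log\left(1+\sum_{k=0}^{\infty}2^k\right)}{1+\sum_{k=0}^{\infty}2^k}=\frac{\log(1+\phi)}{1+\phi}.$$
   Context: $\log$ denotes the natural logarithm, $n$ is an integer, and $W_n$ denotes the $n$-th branch of the Lambert $W$ function (with $W_0$ the principal branch), so $W_n(z)e^{W_n(z)}=z$. In the paper the divergent geometric series $\phi=1+2+2^2+2^3+\cdots$ is assigned the value $\phi=-1-W_n(-\log2)/\log2$, one value for each integer $n$.
   Formalization: With the principal logarithm the identity fails for every n other than 0 and -1 (e.g. n = 1), so log(1+φ) is taken there to be a value of the multivalued logarithm on some branch, the same throughout; for n = 0 and n = -1 it is the principal value. *)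

theory Defs
  imports "HOL-Analysis.Analysis"
begin

text \<open>
  The ranges of the branches of the Lambert W function, with the usual numbering and closure
  conventions (Corless, Gonnet, Hare, Jeffrey and Knuth, 1996). For nonzero \<open>w\<close>, the number
  \<open>Im w + Arg w\<close> is an argument of \<open>w * exp w\<close>, so the ranges are separated by the preimages of
  the branch cut, the negative real axis, and they are closed on the side where \<open>Arg z = pi\<close>.
  On the negative real axis of the \<open>w\<close>-plane the separating point is \<open>-1\<close>, the critical point
  of \<open>w * exp w\<close>: the part right of it belongs to branch 0, the part left of it to branch -1, and
  \<open>-1\<close> itself to both.  Since \<open>Arg 0 = 0\<close>, the point 0 lies in the range of branch 0 only.
\<close>

definition lambert_W_range :: "int \<Rightarrow> complex set" where
  "lambert_W_range n =
     (let R = {w. (2 * of_int n - 1) * pi < Im w + Arg w \<and> Im w + Arg w \<le> (2 * of_int n + 1) * pi}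
      in if n = 0 then R - complex_of_real ` {..< -1}
         else if n = -1 then R \<union> complex_of_real ` {.. -1}
         else R)"

text \<open>Only \<open>lambert_W n 0\<close> with \<open>n \<noteq> 0\<close> is left unspecified.\<close>

definition lambert_W :: "int \<Rightarrow> complex \<Rightarrow> complex" where
  "lambert_W n z = (THE w. w \<in> lambert_W_range n \<and> w * exp w = z)"

text \<open>The values of the multivalued natural logarithm; \<open>k = 0\<close> is the principal value.\<close>

definition Ln_branch :: "int \<Rightarrow> complex \<Rightarrow> complex" where
  "Ln_branch k z = Ln z + 2 * of_int k * of_real pi * \<i>"

text \<open>
  The value assigned, for each integer \<open>n\<close>, to the divergent series \<open>1 + 2 + 2^2 + ...\<close>.
  It is not \<open>suminf (\<lambda>k. 2 ^ k)\<close>, which is meaningless here because the series diverges.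
\<close>

definition pow2_series :: "int \<Rightarrow> complex" where
  "pow2_series n = - 1 - lambert_W n (- of_real (ln 2)) / of_real (ln 2)"

end

theory Submission
  imports Defs
begin

text \<open>
  If \<open>W = lambert_W n (- ln 2)\<close> satisfies \<open>W * exp W = - ln 2\<close>, then \<open>1 + \<phi> = - W / ln 2 = exp (- W)\<close>,
  whose logarithm, on a suitable branch, is \<open>- W = ln 2 * (1 + \<phi>)\<close>. The branch is the principal
  one for \<open>n = 0\<close> and \<open>n = -1\<close> because then \<open>0 < \<bar>Im W\<bar> < pi\<close>.

  What needs work is that the branch \<open>n\<close> contains exactly one solution. Since \<open>- ln 2 < - exp (-1)\<close>,
  no solution is real, and a solution belongs to branch \<open>n\<close> iff \<open>Im w + Arg w = (2 * n + 1) * pi\<close>.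
  For \<open>n \<ge> 0\<close> the solutions are parametrized by \<open>b = Im w\<close> in \<open>(2 * n * pi, (2 * n + 1) * pi)\<close>, where
  \<open>\<bar>w * exp w\<bar>\<close> is strictly increasing in \<open>b\<close> and takes the value \<open>ln 2\<close> between \<open>b = 2 * n * pi + pi / 4\<close>
  and \<open>b = 2 * n * pi + pi / 2\<close>. Complex conjugation exchanges the branches \<open>n\<close> and \<open>- n - 1\<close>.
\<close>

section \<open>The argument of \<open>w * exp w\<close> and the branch ranges\<close>

lemma mult_exp_eq_polar:
  "w * exp w = rcis (cmod w * exp (Re w)) (Im w + Arg w)"
proof -
  have "w * exp w = rcis (cmod w) (Arg w) * (of_real (exp (Re w)) * cis (Im w))"
    by (simp add: rcis_cmod_Arg exp_eq_polar)
  also have "\<dots> = rcis (cmod w * exp (Re w)) (Im w + Arg w)"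
    by (simp add: rcis_def cis_mult[symmetric] ac_simps)
  finally show ?thesis .
qed

text \<open>This is \<open>1 + s \<le> exp s\<close> at \<open>s = -(t + 1)\<close>, multiplied by
  \<open>exp t\<close>. It excludes real solutions and later bounds \<open>lambert_modulus\<close>
  from above.\<close>

lemma mult_exp_ge_neg_exp_neg_one:
  fixes t :: real
  shows "- exp (-1) \<le> t * exp t"
proof -
  have "- t * exp (t + 1) \<le> exp (-(t + 1)) * exp (t + 1)"
    using exp_ge_add_one_self[of "-(t+1)"] by (intro mult_right_mono) auto
  also have "\<dots> = 1" by (simp flip: exp_add)
  finally have "- t * exp (t + 1) * exp (-1) \<le> 1 * exp (-1)"
    by (intro mult_right_mono) auto
  moreover have "exp (t + 1) * exp (-1) = exp t" by (simp flip: exp_add)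
  ultimately show ?thesis by (simp add: mult.assoc)
qed

lemma mult_exp_eq_imp_nonreal:
  assumes "w * exp w = - of_real x" "exp (-1) < x"
  shows "Im w \<noteq> 0"
proof
  assume "Im w = 0"
  then have w: "w = of_real (Re w)" by (simp add: complex_eq_iff)
  have "of_real (Re w * exp (Re w)) = (of_real (- x) :: complex)"
    using assms(1) by (subst (asm) (1 2) w) (simp add: exp_of_real)
  then have "Re w * exp (Re w) = - x" by (simp only: of_real_eq_iff)
  with mult_exp_ge_neg_exp_neg_one[of "Re w"] assms(2) show False by simp
qed

text \<open>A negative real value forces \<open>Im w + Arg w\<close> to be an odd multiple of pi,
  and the half-open window of length 2 pi contains only one, its closed right end. The rays treated
  separately for branches 0 and -1 are real, so \<open>Im w \<noteq> 0\<close> avoids them.\<close>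

lemma mem_lambert_W_range_iff:
  assumes eq: "w * exp w = - of_real x" and x: "exp (-1) < x"
  shows "w \<in> lambert_W_range n \<longleftrightarrow> Im w + Arg w = (2 * of_int n + 1) * pi"
proof -
  let ?s = "Im w + Arg w"
  have im: "Im w \<noteq> 0" using mult_exp_eq_imp_nonreal[OF eq x] .
  have x0: "0 < x" using x exp_gt_zero[of "-1 :: real"] by linarith
  have "Im (w * exp w) = 0" "Re (w * exp w) = - x" using eq by simp_all
  then have s: "cmod w * exp (Re w) * sin ?s = 0" "cmod w * exp (Re w) * cos ?s = - x"
    by (simp_all only: mult_exp_eq_polar Re_rcis Im_rcis)
  have "cmod w > 0" using im by auto
  with s x0 have "sin ?s = 0" "cos ?s < 0"
    by (auto, smt (verit) mult_nonneg_nonneg exp_gt_zero)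
  then have "cos ?s = -1"
    using sin_cos_squared_add[of ?s] by (auto simp: power2_eq_1_iff)
  then obtain k :: int where k: "?s = (2 * of_int k + 1) * pi"
    using cos_eq_minus1[of ?s] by (auto simp: algebra_simps)
  have "(2 * of_int n - 1) * pi < ?s \<and> ?s \<le> (2 * of_int n + 1) * pi \<longleftrightarrow> 
     (2 * real_of_int n - 1) < (2 * of_int k + 1) \<and> (2 * real_of_int k + 1) \<le> (2 * of_int n + 1)"
    unfolding k by (simp only: mult_less_cancel_right_pos mult_le_cancel_right_pos pi_gt_zero)
  also have "\<dots> \<longleftrightarrow> k = n" by linarith
  also have "\<dots> \<longleftrightarrow> ?s = (2 * of_int n + 1) * pi" unfolding k by simp
  finally show ?thesis using im by (auto simp: lambert_W_range_def Let_def)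
qed

text \<open>
  If \<open>Im w + Arg w\<close> is an odd multiple of \<open>pi\<close> and \<open>b = Im w > 0\<close>, then \<open>cmod w = b / sin b\<close> and
  \<open>Re w = - b * cot b\<close>, so that \<open>\<bar>w * exp w\<bar>\<close> is the following function of \<open>b\<close>.
\<close>

definition lambert_modulus :: "real \<Rightarrow> real" where
  "lambert_modulus b = b / sin b * exp (- b * cot b)"

section \<open>Solutions in the upper half-plane\<close>

lemma sin_cos_odd_pi_minus:
  "sin ((2 * real n + 1) * pi - b) = sin b" "cos ((2 * real n + 1) * pi - b) = - cos b"
proof -
  have "(2 * real n + 1) * pi - b = (pi - b) + 2 * of_nat n * pi" by (simp add: algebra_simps)
  then show "sin ((2 * real n + 1) * pi - b) = sin b" "cos ((2 * real n + 1) * pi - b) = - cos b"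
    by (simp_all add: sin_add cos_add sin_diff cos_diff)
qed

lemma sin_pos_between:
  assumes "2 * real n * pi < b" "b < (2 * real n + 1) * pi"
  shows "0 < sin b"
proof -
  have "0 < (2 * real n + 1) * pi - b" "(2 * real n + 1) * pi - b < pi"
    using assms by (simp_all add: algebra_simps)
  then have "0 < sin ((2 * real n + 1) * pi - b)" by (rule sin_gt_zero)
  then show ?thesis by (simp only: sin_cos_odd_pi_minus)
qed

lemma upper_solution_iff:
  fixes n :: nat
  assumes x: "exp (-1) < x"
  shows "w * exp w = - of_real x \<and> Im w + Arg w = (2 * real n + 1) * pi \<longleftrightarrow>
    2 * real n * pi < Im w \<and> Im w < (2 * real n + 1) * pi \<and>
    Re w = - Im w * cot (Im w) \<and> lambert_modulus (Im w) = x"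
    (is "?L \<longleftrightarrow> ?R")
proof
  assume L: ?L
  let ?b = "Im w"
  have im: "?b \<noteq> 0" using L x mult_exp_eq_imp_nonreal by blast
  \<comment> \<open>The sum \<open>?b + Arg w\<close> is at least pi while \<open>Arg w\<close> is
    at most pi, so a nonzero \<open>?b\<close> is positive.\<close>
  have "0 \<le> 2 * real n * pi" by simp
  then have "pi \<le> ?b + Arg w" using L by (simp add: algebra_simps)
  then have "0 < ?b" using im Arg_bounded[of w] by linarith
  then have \<theta>: "0 < Arg w" "Arg w < pi" using Arg_lt_pi by blast+
  have b: "2 * real n * pi < ?b" "?b < (2 * real n + 1) * pi"
    using L \<theta> by (simp_all add: algebra_simps)
  have sb: "0 < sin ?b" by (rule sin_pos_between[OF b])
  have ar: "Arg w = (2 * real n + 1) * pi - ?b" using L by simp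
  have "rcis (cmod w) (Arg w) = w" by (rule rcis_cmod_Arg)
  then have "Im w = cmod w * sin (Arg w)" "Re w = cmod w * cos (Arg w)"
    by (metis Im_rcis, metis Re_rcis)
  then have "Im w = cmod w * sin ?b" and re: "Re w = - cmod w * cos ?b"
    unfolding ar sin_cos_odd_pi_minus by simp_all
  then have r: "cmod w = ?b / sin ?b" using sb by (metis nonzero_mult_div_cancel_right less_irrefl)
  have re': "Re w = - ?b * cot ?b" using re by (simp add: r cot_def)
  have "- x = Re (w * exp w)" using L by simp
  also have "\<dots> = - (cmod w * exp (Re w))"
    using L sin_cos_odd_pi_minus(2)[of n 0] by (simp only: mult_exp_eq_polar Re_rcis) simp
  finally have "x = lambert_modulus ?b" by (simp add: lambert_modulus_def r re')
  with b re' show ?R by simp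
next
  assume R: ?R
  let ?b = "Im w"
  let ?\<theta> = "(2 * real n + 1) * pi - ?b"
  have b: "2 * real n * pi < ?b" "?b < (2 * real n + 1) * pi" using R by auto
  have sb: "0 < sin ?b" by (rule sin_pos_between[OF b])
  have "0 \<le> 2 * real n * pi" by simp
  then have b0: "0 < ?b" using b by linarith
  have w: "w = rcis (?b / sin ?b) ?\<theta>"
    using R sb by (simp add: complex_eq_iff sin_cos_odd_pi_minus cot_def)
  have ar: "Arg w = ?\<theta>"
  proof (rule Arg_unique)
    show "of_real (?b / sin ?b) * exp (\<i> * of_real ?\<theta>) = w"
      using w by (simp only: rcis_def cis_conv_exp)
    show "0 < ?b / sin ?b" using sb b0 by simp
    show "- pi < ?\<theta>" using b pi_gt_zero by linarith
    show "?\<theta> \<le> pi" using b by (simp add: algebra_simps)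
  qed
  have r: "cmod w = ?b / sin ?b" by (subst w) (use sb b0 in simp)
  have "w * exp w = rcis x ((2 * real n + 1) * pi)"
    using R by (subst mult_exp_eq_polar) (simp add: ar r lambert_modulus_def)
  also have "\<dots> = - of_real x"
    using sin_cos_odd_pi_minus[of n 0] by (simp add: complex_eq_iff)
  finally show ?L using ar by simp
qed

text \<open>The logarithm \<open>g\<close> of the function has derivative
  \<open>((sin b - b * cos b)^2 + (b * sin b)^2) / (b * (sin b)^2)\<close>, which is
  positive.\<close>

lemma lambert_modulus_strict_mono_on:
  "strict_mono_on {2 * real n * pi <..< (2 * real n + 1) * pi} lambert_modulus"
proof (rule strict_mono_onI)
  fix u v assume u: "u \<in> {2 * real n * pi <..< (2 * real n + 1) * pi}"
    and v: "v \<in> {2 * real n * pi <..< (2 * real n + 1) * pi}" and uv: "u < v"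
  have pos: "0 < b" "0 < sin b" if "u \<le> b" "b \<le> v" for b
  proof -
    have "0 \<le> 2 * real n * pi" by simp
    then show "0 < b" using u that unfolding greaterThanLessThan_iff by linarith
    show "0 < sin b" using u v that by (intro sin_pos_between[of n]) auto
  qed
  define g where "g b = ln b - ln (sin b) - b * cot b" for b :: real
  have "\<exists>y. (g has_real_derivative y) (at b) \<and> 0 < y" if "u \<le> b" "b \<le> v" for b
  proof (intro exI conjI)
    note p = pos[OF that]
    show "(g has_real_derivative 1 / b - 2 * cot b + b * (1 + (cot b)\<^sup>2)) (at b)"
      unfolding g_def cot_def using p
      by (auto intro!: derivative_eq_intros simp: divide_inverse power2_eq_square algebra_simps)
    have "1 / b - 2 * cot b + b * (1 + (cot b)\<^sup>2) =
        ((sin b - b * cos b)\<^sup>2 + (b * sin b)\<^sup>2) / (b * (sin b)\<^sup>2)"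
      using p
      by (simp add: cot_def field_simps power2_eq_square) (use sin_cos_squared_add[of b] in algebra)
    also have "\<dots> > 0" using p by (intro divide_pos_pos add_nonneg_pos) auto
    finally show "0 < 1 / b - 2 * cot b + b * (1 + (cot b)\<^sup>2)" .
  qed
  with uv have "g u < g v" by (rule DERIV_pos_imp_increasing)
  moreover have "lambert_modulus b = exp (g b)" if "u \<le> b" "b \<le> v" for b
    using pos[OF that] by (simp add: lambert_modulus_def g_def exp_diff exp_add exp_minus field_simps)
  ultimately show "lambert_modulus u < lambert_modulus v" using uv by simp
qed

text \<open>Intermediate value theorem between \<open>?u\<close>, where \<open>cot\<close> is 1 and
  the value is \<open>sqrt 2 * ?u * exp (- ?u)\<close>, and \<open>?v\<close>, where
  \<open>cot\<close> is 0 and the value is \<open>?v\<close> itself. The bounds on \<open>x\<close>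
  are uniform in \<open>n\<close>.\<close>

lemma lambert_modulus_surj:
  assumes x: "sqrt 2 * exp (-1) \<le> x" "x \<le> pi / 2"
  obtains b where "2 * real n * pi < b" "b < (2 * real n + 1) * pi" "lambert_modulus b = x"
proof -
  let ?u = "pi / 4 + 2 * real n * pi" and ?v = "pi / 2 + 2 * real n * pi"
  have bounds: "2 * real n * pi < b" "b < (2 * real n + 1) * pi" if "?u \<le> b" "b \<le> ?v" for b
  proof -
    have "(2 * real n + 1) * pi = 2 * real n * pi + pi" by (simp add: algebra_simps)
    then show "2 * real n * pi < b" "b < (2 * real n + 1) * pi"
      using that pi_gt_zero by linarith+
  qed
  have su: "sin ?u = sqrt 2 / 2" "cos ?u = sqrt 2 / 2" "sin ?v = 1" "cos ?v = 0"
    by (simp_all add: sin_add cos_add sin_45 cos_45)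
  have "2 / sqrt 2 = sqrt (2 :: real)" by (simp add: real_div_sqrt)
  then have "lambert_modulus ?u = sqrt 2 * (?u * exp (- ?u))"
    unfolding lambert_modulus_def cot_def su
    by (simp only: divide_divide_eq_right times_divide_eq_right[symmetric]) (simp add: ac_simps)
  also have "\<dots> \<le> sqrt 2 * exp (-1)"
    using mult_exp_ge_neg_exp_neg_one[of "- ?u"]
    by (intro mult_left_mono) (simp_all only: mult_minus_left neg_le_iff_le real_sqrt_ge_zero zero_le_numeral)
  finally have "lambert_modulus ?u \<le> x" using x by simp
  moreover have "x \<le> lambert_modulus ?v"
  proof -
    have "0 \<le> 2 * real n * pi" by simp
    then have "x \<le> ?v" using x by linarith
    then show ?thesis unfolding lambert_modulus_def cot_def su by simp
  qed
  moreover have "continuous_on {?u..?v} lambert_modulus"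
  proof -
    have "sin b \<noteq> 0" if "b \<in> {?u..?v}" for b
      using sin_pos_between[OF bounds] that by force
    then show ?thesis unfolding lambert_modulus_def cot_def
      by (intro continuous_intros) auto
  qed
  ultimately obtain b where "?u \<le> b" "b \<le> ?v" "lambert_modulus b = x"
    using IVT'[of lambert_modulus ?u x ?v] by auto
  with bounds show ?thesis using that by blast
qed

section \<open>Exactly one solution on each branch\<close>

lemma ex1_upper_solution:
  fixes n :: nat
  assumes x: "sqrt 2 * exp (-1) \<le> x" "x \<le> pi / 2"
  shows "\<exists>!w. w * exp w = - of_real x \<and> Im w + Arg w = (2 * real n + 1) * pi"
proof -
  have "exp (-1) < sqrt 2 * exp (-1 :: real)" by simp
  with x have x1: "exp (-1) < x" by linarith
  obtain b where b: "2 * real n * pi < b" "b < (2 * real n + 1) * pi" "lambert_modulus b = x"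
    using lambert_modulus_surj[OF x] .
  have inj: "inj_on lambert_modulus {2 * real n * pi <..< (2 * real n + 1) * pi}"
    by (rule strict_mono_on_imp_inj_on[OF lambert_modulus_strict_mono_on])
  show ?thesis unfolding upper_solution_iff[OF x1]
  proof (rule ex1I[of _ "Complex (- b * cot b) b"], goal_cases)
    case 1
    show ?case using b by simp
  next
    case (2 w)
    then have "Im w = b" using b inj by (auto dest: inj_onD)
    with 2 show ?case by (simp add: complex_eq_iff)
  qed
qed

lemma ex1_lambert_solution:
  assumes x: "sqrt 2 * exp (-1) \<le> x" "x \<le> pi / 2"
  shows "\<exists>!w. w \<in> lambert_W_range n \<and> w * exp w = - of_real x"
proof -
  have "exp (-1) < sqrt 2 * exp (-1 :: real)" by simp
  with x have x1: "exp (-1) < x" by linarith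
  have P: "(w \<in> lambert_W_range n \<and> w * exp w = - of_real x) \<longleftrightarrow>
      (w * exp w = - of_real x \<and> Im w + Arg w = (2 * of_int n + 1) * pi)" for w
    using mem_lambert_W_range_iff[OF _ x1] by blast
  show ?thesis
  proof (cases "0 \<le> n")
    case True
    then show ?thesis unfolding P using ex1_upper_solution[OF x, of "nat n"] by simp
  next
    case False
    define m where "m = nat (- n - 1)"
    have m: "real m = - of_int n - 1" using False by (simp add: m_def)
    have *: "(w * exp w = - of_real x \<and> Im w + Arg w = (2 * of_int n + 1) * pi) \<longleftrightarrow>
       (cnj w * exp (cnj w) = - of_real x \<and> Im (cnj w) + Arg (cnj w) = (2 * real m + 1) * pi)" for w
    proof -
      have "w * exp w = - of_real x \<longleftrightarrow> cnj (w * exp w) = cnj (- of_real x)"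
        by (simp only: complex_cnj_cancel_iff)
      then have 1: "w * exp w = - of_real x \<longleftrightarrow> cnj w * exp (cnj w) = - of_real x"
        by (simp add: exp_cnj)
      \<comment> \<open>On the negative real axis this fails, as \<open>Arg\<close> is pi there for
        both points; solutions are nonreal.\<close>
      have 2: "Arg (cnj w) = - Arg w" if "Im w \<noteq> 0"
        using that by (simp add: Arg_cnj complex_is_Real_iff)
      show ?thesis using 1 2 mult_exp_eq_imp_nonreal[OF _ x1, of w] by (auto simp: m algebra_simps)
    qed
    have "\<exists>!w. cnj w * exp (cnj w) = - of_real x \<and> Im (cnj w) + Arg (cnj w) = (2 * real m + 1) * pi"
      using ex1_upper_solution[OF x, of m] by (metis complex_cnj_cnj)
    then show ?thesis unfolding P * .
  qed
qed

lemma lambert_W_neg_real: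
  assumes x: "sqrt 2 * exp (-1) \<le> x" "x \<le> pi / 2"
  shows "lambert_W n (- of_real x) * exp (lambert_W n (- of_real x)) = - of_real x"
    and "Im (lambert_W n (- of_real x)) + Arg (lambert_W n (- of_real x)) = (2 * of_int n + 1) * pi"
proof -
  have "exp (-1) < sqrt 2 * exp (-1 :: real)" by simp
  with x have x1: "exp (-1) < x" by linarith
  have W: "lambert_W n (- of_real x) \<in> lambert_W_range n \<and>
      lambert_W n (- of_real x) * exp (lambert_W n (- of_real x)) = - of_real x"
    unfolding lambert_W_def by (rule theI'[OF ex1_lambert_solution[OF x]])
  then show "lambert_W n (- of_real x) * exp (lambert_W n (- of_real x)) = - of_real x" by blast
  then show "Im (lambert_W n (- of_real x)) + Arg (lambert_W n (- of_real x)) = (2 * of_int n + 1) * pi"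
    using W mem_lambert_W_range_iff[OF _ x1] by blast
qed

lemma ln_2_bounds: "sqrt 2 * exp (-1) \<le> ln (2 :: real)" "ln 2 \<le> pi / 2"
proof -
  have s: "sqrt 2 \<le> (1.42 :: real)" by (rule real_le_lsqrt) (auto simp: power2_eq_square)
  \<comment> \<open>Here 2.5 = 1 + 1 + 1/2, and 1.42 / 2.5 = 0.568 leaves room below 2/3.\<close>
  have "(2.5 :: real) \<le> exp 1" using exp_lower_Taylor_quadratic[of 1] by simp
  then have "sqrt 2 / exp 1 \<le> 1.42 / (2.5 :: real)" using s by (intro frac_le) auto
  also have "\<dots> \<le> 2 / 3" by simp
  also have "\<dots> \<le> ln 2" by (rule ln2_ge_two_thirds)
  finally show "sqrt 2 * exp (-1) \<le> ln (2 :: real)" by (simp add: exp_minus field_simps)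
  have "ln (2 :: real) \<le> 1" using ln_le_minus_one[of 2] by simp
  then show "ln 2 \<le> pi / 2" using pi_ge_two by simp
qed

lemma Ln_branch_exp: "\<exists>k. Ln_branch k (exp z) = z"
proof -
  have "exp (Ln (exp z)) = exp z" by (simp add: exp_Ln)
  then obtain k :: int where "Ln (exp z) = z + of_int (2 * k) * pi * \<i>"
    unfolding exp_eq by auto
  then have "Ln_branch (- k) (exp z) = z" by (simp add: Ln_branch_def)
  then show ?thesis ..
qed

theorem mainTheorem6:
  fixes n :: int and \<phi> :: complex
  assumes "\<phi> = - 1 - lambert_W n (- of_real (ln 2)) / of_real (ln 2)"
  shows "\<exists>k :: int. (n \<in> {-1, 0} \<longrightarrow> k = 0) \<and>
           complex_of_real (ln 2) = Ln_branch k (1 + pow2_series n) / (1 + pow2_series n) \<and>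
           Ln_branch k (1 + pow2_series n) / (1 + pow2_series n) = Ln_branch k (1 + \<phi>) / (1 + \<phi>)"
proof -
  define W where "W = lambert_W n (- of_real (ln 2))"
  have W: "W * exp W = - of_real (ln 2)" "Im W + Arg W = (2 * of_int n + 1) * pi"
    unfolding W_def by (rule lambert_W_neg_real[OF ln_2_bounds])+
  have "- W / of_real (ln 2) = exp (- W)"
    using W(1) by (simp add: exp_minus field_simps)
  then have \<phi>: "1 + \<phi> = exp (- W)" "1 + pow2_series n = exp (- W)"
    by (simp_all add: assms pow2_series_def flip: W_def)
  have "\<exists>k. (n \<in> {-1, 0} \<longrightarrow> k = 0) \<and> Ln_branch k (exp (- W)) = - W"
  proof (cases "n \<in> {-1, 0}")
    case True
    have "exp (-1) < sqrt 2 * exp (-1 :: real)" by simp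
    then have "Im W \<noteq> 0"
      using mult_exp_eq_imp_nonreal[OF W(1)] ln_2_bounds(1) by linarith
    \<comment> \<open>\<open>Im W\<close> and \<open>Arg W\<close> are nonzero with the same sign
      and add up to pi or -pi, so \<open>\<bar>Im W\<bar> < pi\<close> and \<open>Ln\<close> inverts
      \<open>exp\<close> at \<open>- W\<close>.\<close>
    then have "- pi < Im (- W)" "Im (- W) \<le> pi"
      using True W(2) Arg_lt_pi[of W] Arg_less_0[of W] Arg_bounded[of W] by auto
    then have "Ln_branch 0 (exp (- W)) = - W" by (simp add: Ln_branch_def)
    then show ?thesis by blast
  next
    case False
    then show ?thesis using Ln_branch_exp by blast
  qed
  then obtain k where k: "n \<in> {-1, 0} \<longrightarrow> k = 0" "Ln_branch k (exp (- W)) = - W" by blast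
  have "of_real (ln 2) = - W / exp (- W)" using W(1) by (simp add: exp_minus divide_inverse)
  then show ?thesis unfolding \<phi> using k by metis
qed

end
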